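(* Let $k\ge 1$ be an integer, let $S_k$ be the shift map on $\Sigma_k=\{1,2,\ldots,k\}^{\mathbb{Z}}$, and let $\nu$ be a non-atomic shift-invariant probability measure on $(\Sigma_k,\mathfrak{B}_k)$. Let $n\ge 2$ be an integer and assume that the system $(\Sigma_k,\mathfrak{B}_k,\nu,S_k)$ is AT$(n)$ but not AT$(n-1)$. Then for every $\varepsilon>0$, every $\delta>0$ and every positive integer $M$ there exist finite sets $\Lambda^{1},\Lambda^{2},\ldots,\Lambda^{n}\subset\mathbb{Z}$ with $\min\{|\Lambda^{i}| : i=1,2,\ldots,n\}\ge M$, and funny words $W^{i}$ on the alphabet $\{1,\ldots,k\}$ based on $\Lambda^{i}$, for $i=1,2,\ldots,n$, such that \[\sum_{i=1}^{n}|\Lambda^{i}|\,\nu\left(\{x\in\Sigma_{k}: d_{\Lambda^{i}}(x|_{\Lambda^{i}},W^{i})<\varepsilon\}\right)>1-\delta.\]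
   Context: AT$(n)$: Let $T$ be a measure preserving automorphism (invertible measure preserving transformation) of a standard probability space $(X,\mathfrak{B},\mu)$, and let $L^1_+(X,\mu)$ be the set of nonnegative functions in $L^1(X,\mu)$. For an integer $n\ge 1$, the system $(X,\mathfrak{B},\mu,T)$ (or simply $T$) is AT$(n)$ if for every $\varepsilon>0$ and every finite set of functions $f_1,\ldots,f_r\in L^1_+(X,\mu)$ there exist $n$ functions $g_1,\ldots,g_n\in L^1_+(X,\mu)$, a positive integer $N$, nonnegative reals $\alpha_{i,j}^{(m)}$ ($1\le m\le n$, $1\le i\le r$, $1\le j\le N$) and integers $t_j^{(m)}$ ($1\le m\le n$, $1\le j\le N$) such that \[\Big\|f_{i}-\sum_{m=1}^{n}\sum_{j=1}^{N}\alpha_{i,j}^{(m)}\,g_{m}\circ T^{t_{j}^{(m)}}\Big\|_{1}<\varepsilon\quad\text{for } i=1,\ldots,r.\] Shift: $\mathfrak{B}_k$ is the $\sigma$-algebra on $\Sigma_k=\{1,\ldots,k\}^{\mathbb{Z}}$ generated by the cylinder sets, and $S_k:\Sigma_k\to\Sigma_k$ is given by $(S_kx)_n=x_{n+1}$ for $x=(x_n)_{n\in\mathbb{Z}}$. Funny words: for a finite set $\Lambda\subset\mathbb{Z}$, a funny word on $\{1,\ldots,k\}$ based on $\Lambda$ is a finite sequence $W=(W_n)_{n\in\Lambda}$ with $W_n\in\{1,\ldots,k\}$. The Hamming distance of two funny words $W,W'$ based on the same $\Lambda$ is $d_\Lambda(W,W')=\frac{1}{|\Lambda|}\operatorname{card}\{n\in\Lambda: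 W_n\ne W'_n\}$. For $x\in\Sigma_k$, $x|_\Lambda$ denotes the funny word $(x_n)_{n\in\Lambda}$. *)

theory Defs
  imports "HOL-Probability.Probability"
begin

definition nonatomic :: "'a measure \<Rightarrow> bool" where
  "nonatomic M \<longleftrightarrow>
     (\<forall>A\<in>sets M. emeasure M A > 0 \<longrightarrow>
        (\<exists>B\<in>sets M. B \<subseteq> A \<and> 0 < emeasure M B \<and> emeasure M B < emeasure M A))"

definition measure_automorphism :: "'a measure \<Rightarrow> ('a \<Rightarrow> 'a) \<Rightarrow> bool" where
  "measure_automorphism M T \<longleftrightarrow>
     T \<in> measurable M M \<and> bij_betw T (space M) (space M) \<and>
     the_inv_into (space M) T \<in> measurable M M \<and> distr M M T = M"

text \<open>The inverse is taken on the space of \<open>M\<close>, where \<open>T\<close> is a bijection when it is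
  an automorphism; \<open>T\<close> need not be injective on the whole type.\<close>

definition int_iterate :: "'a measure \<Rightarrow> ('a \<Rightarrow> 'a) \<Rightarrow> int \<Rightarrow> 'a \<Rightarrow> 'a" where
  "int_iterate M T t =
     (if t \<ge> 0 then T ^^ nat t else the_inv_into (space M) T ^^ nat (- t))"

text \<open>Elements of \<open>L\<^sup>1\<^sub>+\<close> are represented by real-valued functions, without passing to
  classes modulo null sets.\<close>

definition L1_nonneg :: "'a measure \<Rightarrow> ('a \<Rightarrow> real) set" where
  "L1_nonneg M = {f. integrable M f \<and> (AE x in M. 0 \<le> f x)}"

definition L1_norm :: "'a measure \<Rightarrow> ('a \<Rightarrow> real) \<Rightarrow> real" where
  "L1_norm M f = (\<integral>x. \<bar>f x\<bar> \<partial>M)"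

text \<open>Meant for \<open>n \<ge> 1\<close> and \<open>T\<close> a \<^const>\<open>measure_automorphism\<close> of a standard probability
  space \<open>M\<close>. Then the functions whose norms are taken below are integrable, so that the
  Bochner integral in \<^const>\<open>L1_norm\<close> does not take its default value 0.\<close>

definition AT :: "nat \<Rightarrow> 'a measure \<Rightarrow> ('a \<Rightarrow> 'a) \<Rightarrow> bool" where
  "AT n M T \<longleftrightarrow>
     (\<forall>\<epsilon>>0. \<forall>r. \<forall>f :: nat \<Rightarrow> 'a \<Rightarrow> real. (\<forall>i\<in>{1..r}. f i \<in> L1_nonneg M) \<longrightarrow>
        (\<exists>(g :: nat \<Rightarrow> 'a \<Rightarrow> real) (N :: nat) (\<alpha> :: nat \<Rightarrow> nat \<Rightarrow> nat \<Rightarrow> real) (t :: nat \<Rightarrow> nat \<Rightarrow> int).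
           (\<forall>m\<in>{1..n}. g m \<in> L1_nonneg M) \<and> N > 0 \<and>
           (\<forall>m\<in>{1..n}. \<forall>i\<in>{1..r}. \<forall>j\<in>{1..N}. \<alpha> m i j \<ge> 0) \<and>
           (\<forall>i\<in>{1..r}.
              L1_norm M (\<lambda>x. f i x -
                (\<Sum>m=1..n. \<Sum>j=1..N. \<alpha> m i j * g m (int_iterate M T (t m j) x))) < \<epsilon>)))"

text \<open>The space \<open>{1..k}\<^sup>\<int>\<close> with the \<open>\<sigma>\<close>-algebra generated by its cylinder sets. Only the
  space and the \<open>\<sigma>\<close>-algebra of this product are of interest; its measure is irrelevant.\<close>

definition full_shift_space :: "nat \<Rightarrow> (int \<Rightarrow> nat) measure" where
  "full_shift_space k = PiM UNIV (\<lambda>_. count_space {1..k})"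

definition shift_map :: "(int \<Rightarrow> nat) \<Rightarrow> int \<Rightarrow> nat" where
  "shift_map x = (\<lambda>n. x (n + 1))"

lemma space_full_shift_space: "space (full_shift_space k) = {x. \<forall>n. x n \<in> {1..k}}"
  by (auto simp: full_shift_space_def space_PiM PiE_def Pi_def)

lemma sets_full_shift_space:
  "sets (full_shift_space k) =
     sigma_sets {x. \<forall>n. x n \<in> {1..k}}
       {{x. (\<forall>n. x n \<in> {1..k}) \<and> (\<forall>n\<in>\<Lambda>. x n = w n)} | \<Lambda> w. finite \<Lambda>}"
    (is "_ = sigma_sets ?S ?C")
proof
  have gen: "sets (full_shift_space k) =
      sigma_sets ?S {{f\<in>?S. f i \<in> A} | i A. A \<subseteq> {1..k}}"
    using space_full_shift_space[of k]
    unfolding full_shift_space_def sets_PiM_single space_PiM by simp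
  show "sets (full_shift_space k) \<subseteq> sigma_sets ?S ?C"
    unfolding gen
  proof (rule sigma_sets_mono, safe)
    fix i :: int and A :: "nat set" assume A: "A \<subseteq> {1..k}"
    have "(\<Union>a\<in>A. {x\<in>?S. x i = a}) \<in> sigma_sets ?S ?C"
    proof (rule sigma_sets_UNION)
      show "countable ((\<lambda>a. {x\<in>?S. x i = a}) ` A)" by simp
    next
      fix B assume "B \<in> (\<lambda>a. {x\<in>?S. x i = a}) ` A"
      then obtain a where B: "B = {x\<in>?S. x i = a}" by blast
      have "B = {x. (\<forall>n. x n \<in> {1..k}) \<and> (\<forall>n\<in>{i}. x n = (\<lambda>_. a) n)}"
        unfolding B by auto
      then have "B \<in> ?C" by (intro CollectI exI[of _ "{i}"] exI[of _ "\<lambda>_. a"]) simp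
      then show "B \<in> sigma_sets ?S ?C" by (rule sigma_sets.Basic)
    qed
    also have "(\<Union>a\<in>A. {x\<in>?S. x i = a}) = {f\<in>?S. f i \<in> A}" by auto
    finally show "{f\<in>?S. f i \<in> A} \<in> sigma_sets ?S ?C" .
  qed
  have coord: "(\<lambda>x. x n) \<in> measurable (full_shift_space k) (count_space UNIV)" for n
  proof -
    have "(\<lambda>x. x n) \<in> measurable (full_shift_space k) (count_space {1..k})"
      unfolding full_shift_space_def by (rule measurable_component_singleton) simp
    then show ?thesis by (rule measurable_compose) simp
  qed
  show "sigma_sets ?S ?C \<subseteq> sets (full_shift_space k)"
    unfolding space_full_shift_space[symmetric, of k]
  proof (rule sets.sigma_sets_subset, safe)
    fix \<Lambda> :: "int set" and w :: "int \<Rightarrow> nat" assume fin: "finite \<Lambda>"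
    have "{x\<in>space (full_shift_space k). \<forall>n\<in>\<Lambda>. x n = w n} \<in> sets (full_shift_space k)"
    proof (rule sets.sets_Collect_finite_All[OF _ fin])
      fix n
      show "{x\<in>space (full_shift_space k). x n = w n} \<in> sets (full_shift_space k)"
        using measurable_sets[OF coord[of n], of "{w n}"]
        by (simp add: vimage_def Collect_conj_eq Int_commute)
    qed
    then show "{x. (\<forall>n. x n \<in> {1..k}) \<and> (\<forall>n\<in>\<Lambda>. x n = w n)} \<in> sets (full_shift_space k)"
      by (simp add: space_full_shift_space)
  qed
qed

lemma measure_automorphism_shift_map:
  assumes sets: "sets \<nu> = sets (full_shift_space k)" and inv: "distr \<nu> \<nu> shift_map = \<nu>"
  shows "measure_automorphism \<nu> shift_map"
proof -
  have sp: "space \<nu> = {x. \<forall>n. x n \<in> {1..k}}"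
    using sets_eq_imp_space_eq[OF sets] by (simp add: space_full_shift_space)
  have meas: "(\<lambda>x n. x (n + c)) \<in> measurable \<nu> \<nu>" for c :: int
  proof -
    have "(\<lambda>x n. x (n + c)) \<in> measurable (full_shift_space k) (full_shift_space k)"
      unfolding full_shift_space_def
      by (rule measurable_PiM_single')
         (auto simp: space_PiM PiE_def Pi_def intro!: measurable_component_singleton)
    then show ?thesis using measurable_cong_sets[OF sets sets] by simp
  qed
  have inj: "inj_on shift_map (space \<nu>)"
  proof (rule inj_onI, rule ext)
    fix x y :: "int \<Rightarrow> nat" and n assume "shift_map x = shift_map y"
    then have "shift_map x (n - 1) = shift_map y (n - 1)" by simp
    then show "x n = y n" by (simp add: shift_map_def)
  qed
  have preimage: "shift_map (\<lambda>n. x (n + - 1)) = x" for x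
    by (simp add: shift_map_def)
  have bij: "bij_betw shift_map (space \<nu>) (space \<nu>)"
    unfolding bij_betw_def
  proof (intro conjI inj equalityI subsetI)
    fix y assume "y \<in> shift_map ` space \<nu>"
    then show "y \<in> space \<nu>" by (auto simp: sp shift_map_def)
  next
    fix y assume "y \<in> space \<nu>"
    then show "y \<in> shift_map ` space \<nu>"
      by (intro image_eqI[of _ _ "\<lambda>n. y (n + - 1)"]) (auto simp: sp preimage[simplified])
  qed
  have "the_inv_into (space \<nu>) shift_map x = (\<lambda>n. x (n + - 1))" if "x \<in> space \<nu>" for x
    by (rule the_inv_into_f_eq[OF inj preimage]) (use that in \<open>auto simp: sp\<close>)
  then have "the_inv_into (space \<nu>) shift_map \<in> measurable \<nu> \<nu>"
    using meas[of "- 1"] by (simp cong: measurable_cong)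
  then show ?thesis
    using meas[of 1] bij inv by (simp add: measure_automorphism_def shift_map_def[abs_def])
qed

text \<open>A funny word based on \<open>\<Lambda>\<close> is a function that is \<^term>\<open>undefined\<close> outside \<open>\<Lambda>\<close>.\<close>

definition funny_words :: "nat \<Rightarrow> int set \<Rightarrow> (int \<Rightarrow> nat) set" where
  "funny_words k \<Lambda> = (\<Lambda> \<rightarrow>\<^sub>E {1..k})"

definition hamming_dist :: "int set \<Rightarrow> (int \<Rightarrow> nat) \<Rightarrow> (int \<Rightarrow> nat) \<Rightarrow> real" where
  "hamming_dist \<Lambda> W W' = real (card {n\<in>\<Lambda>. W n \<noteq> W' n}) / real (card \<Lambda>)"

end

theory Submission
  imports Defs
begin

text \<open>Apply AT(n) to the indicators of the cells of a finite partition that refines the partition by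
  the symbol at 0 and has cells of measure at most \<open>\<kappa>\<close>. Let \<open>\<beta>\<^sub>m(z)\<close> be the total weight of
  \<open>g\<^sub>m \<circ> T\<^sup>z\<close> in the approximations. As the indicators sum to 1, so do, approximately, the functions
  \<open>\<beta>\<^sub>m(z) g\<^sub>m \<circ> T\<^sup>z\<close>. Hence the total mass \<open>p\<^sub>m\<close> of the \<open>m\<close>-th family satisfies \<open>\<Sum> p\<^sub>m \<approx> 1\<close>, and
  \<open>\<beta>\<^sub>m(z) g\<^sub>m\<close> exceeds 1 only by little in total. As the cells are disjoint, points distributed according
  to \<open>g\<^sub>m\<close> have, at most positions weighted by \<open>\<beta>\<^sub>m\<close>, the name that carries the largest weight there.
  Truncating \<open>\<beta>\<^sub>m\<close> and \<open>g\<^sub>m\<close> at levels \<open>a\<close> and \<open>b\<close> with \<open>a b \<le> 1\<close> loses little mass, and averaging over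
  the rectangle of levels below \<open>(a, b)\<close> yields level sets \<open>\<Lambda>\<close> of \<open>\<beta>\<^sub>m\<close> and \<open>E\<close> of \<open>g\<^sub>m\<close> for which
  \<open>|\<Lambda>| \<nu>(E)\<close>, minus a multiple of the total mismatch, is nearly \<open>p\<^sub>m\<close>. By Markov's inequality the
  Hamming ball in \<open>E\<close> inherits this bound, and small cells force \<open>\<Lambda>\<close> to be large.\<close>

section \<open>Truncation, level sets and the construction of a single tower\<close>

text \<open>The mass above level \<open>b\<close> is Lipschitz in \<open>b\<close>, starts from the
  full integral at \<open>b = 0\<close> and tends to 0, so it takes the value
  \<open>\<theta>\<close>. Finite measures cover both \<open>g\<close> under the probability measure
  and \<open>\<beta>\<close> under a counting measure.\<close>

lemma (in finite_measure) ex_truncation_level: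
  fixes f :: "'a \<Rightarrow> real"
  assumes int: "integrable M f" and nn: "\<And>x. 0 \<le> f x"
    and \<theta>: "0 < \<theta>" "\<theta> < (\<integral>x. f x \<partial>M)"
  shows "\<exists>b>0. (\<integral>x. max 0 (f x - b) \<partial>M) = \<theta>"
proof -
  define h where "h b = (\<integral>x. max 0 (f x - b) \<partial>M)" for b
  have int_h: "integrable M (\<lambda>x. max 0 (f x - b))" for b
    using int by simp
  have "(measure M (space M))-lipschitz_on UNIV h"
  proof (rule lipschitz_onI)
    fix b b' :: real
    have "dist (h b) (h b') = \<bar>\<integral>x. max 0 (f x - b) - max 0 (f x - b') \<partial>M\<bar>"
      by (simp add: h_def int_h dist_real_def)
    also have "\<dots> \<le> (\<integral>x. \<bar>max 0 (f x - b) - max 0 (f x - b')\<bar> \<partial>M)"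
      by (rule integral_abs_bound)
    also have "\<dots> \<le> (\<integral>x. \<bar>b - b'\<bar> \<partial>M)"
      using int_h by (intro integral_mono) auto
    finally show "dist (h b) (h b') \<le> measure M (space M) * dist b b'"
      by (simp add: dist_real_def)
  qed simp
  then have cont: "continuous_on UNIV h"
    by (rule lipschitz_on_continuous_on)
  have "(\<lambda>i. h (real i)) \<longlonglongrightarrow> (\<integral>x. 0 \<partial>M)"
    unfolding h_def
  proof (rule integral_dominated_convergence[where w = f])
    show "AE x in M. (\<lambda>i. max 0 (f x - real i)) \<longlonglongrightarrow> 0"
    proof (intro AE_I2 tendsto_eventually)
      fix x
      obtain j where j: "f x \<le> real j" using real_arch_simple by blast
      show "\<forall>\<^sub>F i in sequentially. max 0 (f x - real i) = 0"
        using j by (intro eventually_sequentiallyI[of j]) (auto simp: max_def intro: order_trans)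
    qed
  qed (use int nn in \<open>auto simp: max_def\<close>)
  then have "\<forall>\<^sub>F i in sequentially. h (real i) < \<theta>"
    using \<theta> by (intro order_tendstoD(2)) auto
  then obtain i where i: "h (real i) < \<theta>"
    by (auto dest: eventually_happens)
  have h0: "h 0 = (\<integral>x. f x \<partial>M)"
    using nn by (simp add: h_def max_def)
  obtain b where b: "0 \<le> b" "h b = \<theta>"
    using IVT2'[of h "real i" \<theta> 0] i \<theta> h0 continuous_on_subset[OF cont] by auto
  with h0 \<theta> have "b \<noteq> 0" by auto
  with b show ?thesis by (auto simp: h_def intro!: exI[of _ b])
qed

text \<open>Layer cake: \<open>min (f x) b\<close> is \<open>b\<close> times the probability that a
  uniform level \<open>s\<close> in \<open>{0<..<b}\<close> lies below \<open>f x\<close>. By Fubini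
  the left side is \<open>b\<close> times the average over \<open>s\<close> of the level-set
  integrals, so some level reaches the average. The weight \<open>w\<close> may change sign.\<close>

lemma (in finite_measure) ex_level_set_ge_average:
  fixes f w :: "'a \<Rightarrow> real"
  assumes f: "f \<in> borel_measurable M" "\<And>x. 0 \<le> f x"
    and w: "integrable M w" and b: "0 < (b::real)"
  shows "\<exists>s. (\<integral>x. min (f x) b * w x \<partial>M) \<le> b * (\<integral>x. indicator {y. s < f y} x * w x \<partial>M)"
proof (rule ccontr)
  assume "\<not> ?thesis"
  then have less: "b * (\<integral>x. indicator {y. s < f y} x * w x \<partial>M) < (\<integral>x. min (f x) b * w x \<partial>M)" for s
    by (auto simp: not_le)
  define P where "P = uniform_measure lborel {0<..<b}"
  interpret P: prob_space P
    unfolding P_def using b by (intro prob_space_uniform_measure) auto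
  interpret PM: pair_sigma_finite P M
    by standard
  have sets_P [measurable_cong]: "sets P = sets borel" by (simp add: P_def)
  note [measurable] = f(1)
  have [measurable]: "w \<in> borel_measurable M" using w by auto
  have "integrable (P \<Otimes>\<^sub>M M) (\<lambda>(s, x). w x)"
    using w by (intro PM.Fubini_integrable) auto
  then have int: "integrable (P \<Otimes>\<^sub>M M) (\<lambda>(s, x). indicator {y. s < f y} x * w x)"
    by (rule Bochner_Integration.integrable_bound)
       (auto simp: indicator_def intro!: AE_I2)
  have lev: "(\<integral>s. indicator {y. s < f y} x \<partial>P) = min (f x) b / b" for x
  proof -
    have "(\<integral>s. indicator {y. s < f y} x \<partial>P) = measure P {s. s < f x}"
    proof -
      have "(\<lambda>s. indicator {y. s < f y} x :: real) = indicator {s. s < f x}"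
        by (auto simp: indicator_def)
      then show ?thesis by simp
    qed
    also have "\<dots> = min (f x) b / b"
    proof -
      have "{0<..<b} \<inter> {s. s < f x} = {0<..<min (f x) b}" by auto
      then show ?thesis
        using b f(2)[of x] by (simp add: P_def measure_uniform_measure)
    qed
    finally show ?thesis .
  qed
  have "(\<integral>s. b * (\<integral>x. indicator {y. s < f y} x * w x \<partial>M) \<partial>P)
     = b * (\<integral>x. (\<integral>s. indicator {y. s < f y} x * w x \<partial>P) \<partial>M)"
    using PM.Fubini_integral[OF int] by simp
  also have "\<dots> = (\<integral>x. min (f x) b * w x \<partial>M)"
    using b by (simp add: lev)
  finally have eq: "(\<integral>s. b * (\<integral>x. indicator {y. s < f y} x * w x \<partial>M) \<partial>P)
     = (\<integral>x. min (f x) b * w x \<partial>M)" .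
  have "(\<integral>s. b * (\<integral>x. indicator {y. s < f y} x * w x \<partial>M) \<partial>P) < (\<integral>x. min (f x) b * w x \<partial>M)"
    using PM.integrable_fst'[OF int] less by (intro P.expectation_less) auto
  with eq show False by simp
qed

text \<open>\<open>D z\<close> is the set of points whose name is wrong at position \<open>z\<close>; the weighted family
  \<open>\<beta> z * (g \<circ> T\<^sup>z)\<close> is replaced by the flat family of the translates, indexed by a level set \<open>\<Lambda>\<close>
  of \<open>\<beta>\<close>, of a level set \<open>E\<close> of \<open>g\<close>. The levels \<open>a\<close> and \<open>b\<close> at which \<open>\<beta>\<close> and \<open>g\<close> lose the
  fraction \<open>\<theta>\<close> of their mass satisfy \<open>a * b < 1\<close>, because of
  \<open>max 0 (\<beta> z - a) * max 0 (g x - b) \<le> max 0 (\<beta> z * g x - 1)\<close> if \<open>a * b \<ge> 1\<close>; so averaging over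
  the levels in \<open>{0..a} \<times> {0..b}\<close> loses nothing.\<close>

lemma (in prob_space) ex_tower:
  fixes g :: "'a \<Rightarrow> real" and \<beta> :: "'b \<Rightarrow> real" and D :: "'b \<Rightarrow> 'a set"
  assumes g: "integrable M g" "\<And>x. 0 \<le> g x"
    and Z: "finite Z" and \<beta>: "\<And>z. 0 \<le> \<beta> z"
    and D: "\<And>z. z \<in> Z \<Longrightarrow> D z \<in> sets M"
    and excess: "(\<Sum>z\<in>Z. \<integral>x. max 0 (\<beta> z * g x - 1) \<partial>M) \<le> \<zeta>"
    and mismatch: "(\<Sum>z\<in>Z. \<beta> z * (\<integral>x. g x * indicator (D z) x \<partial>M)) \<le> 2 * \<zeta>"
    and small: "\<And>z. z \<in> Z \<Longrightarrow> prob (space M - D z) \<le> \<kappa>"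
    and p: "p = sum \<beta> Z * (\<integral>x. g x \<partial>M)" "\<sigma> < p" "p \<le> 2"
    and \<epsilon>: "0 < \<epsilon>" "\<epsilon> \<le> 1" and \<sigma>: "0 < \<sigma>"
    and \<zeta>: "8 * \<zeta> \<le> \<epsilon> * \<sigma>" "64 * \<zeta> < \<sigma> ^ 3"
    and \<kappa>: "0 < \<kappa>" "4 * \<kappa> * real K \<le> \<sigma>"
  shows "\<exists>\<Lambda>\<subseteq>Z. K \<le> card \<Lambda> \<and>
    p - \<sigma> \<le> real (card \<Lambda>) * prob {x \<in> space M. real (card {z\<in>\<Lambda>. x \<in> D z}) < \<epsilon> * real (card \<Lambda>)}"
proof -
  define G where "G = (\<integral>x. g x \<partial>M)"
  define B where "B = sum \<beta> Z"
  \<comment> \<open>Truncating both factors costs at most \<open>2 * \<theta> * p\<close>, which is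
    at most \<open>\<sigma> / 2\<close> because \<open>p \<le> 2\<close>; and
    \<open>64 * \<theta>^2 * \<sigma>\<close> is the \<open>\<sigma>^3\<close> of the bound on
    \<open>\<zeta>\<close>.\<close>
  define \<theta> where "\<theta> = \<sigma> / 8"
  have "0 \<le> G" "0 \<le> B" unfolding G_def B_def using g \<beta> by (auto intro: sum_nonneg)
  moreover have pBG: "p = B * G" using p by (simp add: B_def G_def)
  ultimately have G: "0 < G" and B: "0 < B" using p \<sigma> by (auto simp: zero_less_mult_iff order_less_le)
  have \<theta>: "0 < \<theta>" "\<theta> < 1" using p \<sigma> by (auto simp: \<theta>_def)

  obtain b where b: "0 < b" "(\<integral>x. max 0 (g x - b) \<partial>M) = \<theta> * G"
    using ex_truncation_level[OF g, of "\<theta> * G"] \<theta> G unfolding G_def by auto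
  interpret Z: finite_measure "count_space Z"
    using Z by (rule finite_measure_count_space)
  obtain a where a: "0 < a" "(\<Sum>z\<in>Z. max 0 (\<beta> z - a)) = \<theta> * B"
    using Z.ex_truncation_level[of \<beta> "\<theta> * B"] \<theta> B \<beta> Z unfolding B_def
    by (auto simp: lebesgue_integral_count_space_finite integrable_count_space)

  have int_trunc: "integrable M (\<lambda>x. max 0 (g x - c))" "integrable M (\<lambda>x. min (g x) c)"
    "integrable M (\<lambda>x. max 0 (c * g x - 1))" for c
    using g by auto
  have "\<not> 1 \<le> a * b"
  proof
    assume ab: "1 \<le> a * b"
    have pw: "max 0 (\<beta> z - a) * max 0 (g x - b) \<le> max 0 (\<beta> z * g x - 1)" for x z
    proof (cases "a \<le> \<beta> z \<and> b \<le> g x")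
      case True
      then have "(\<beta> z - a) * b + a * (g x - b) \<ge> 0" using a b by simp
      then have "(\<beta> z - a) * (g x - b) \<le> \<beta> z * g x - a * b" by (simp add: algebra_simps)
      with True ab show ?thesis by simp
    qed (auto simp: max_def)
    have "\<theta> * B * (\<theta> * G) = (\<Sum>z\<in>Z. \<integral>x. max 0 (\<beta> z - a) * max 0 (g x - b) \<partial>M)"
      by (simp add: a(2)[symmetric] b(2)[symmetric] sum_distrib_right)
    also have "\<dots> \<le> (\<Sum>z\<in>Z. \<integral>x. max 0 (\<beta> z * g x - 1) \<partial>M)"
      using int_trunc by (intro sum_mono integral_mono pw) auto
    also have "\<dots> \<le> \<zeta>" by (rule excess)
    finally have "\<theta>^2 * p \<le> \<zeta>" by (simp add: pBG power2_eq_square ac_simps)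
    moreover have "\<theta>^2 * \<sigma> < \<theta>^2 * p" using p \<theta> by simp
    moreover have "64 * (\<theta>^2 * \<sigma>) = \<sigma>^3" by (simp add: \<theta>_def power2_eq_square power3_eq_cube)
    ultimately show False using \<zeta> by linarith
  qed
  then have ab: "0 < a * b" "a * b < 1" using a b by auto

  \<comment> \<open>Markov's inequality in the form of a weight: summed over
    \<open>\<Lambda>\<close>, it is \<open>card \<Lambda>\<close> minus the number of mismatches
    over \<open>\<epsilon>\<close>, positive only if fewer than
    \<open>\<epsilon> * card \<Lambda>\<close> positions are wrong.\<close>
  define w where "w z x = 1 - indicator (D z) x / \<epsilon>" for z x
  define K' where "K' = (\<Sum>z\<in>Z. min (\<beta> z) a * (\<integral>x. min (g x) b * w z x \<partial>M))"
  have int_gD: "integrable M (\<lambda>x. g x * indicator (D z) x)" "integrable M (\<lambda>x. min (g x) b * indicator (D z) x)"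
    if "z \<in> Z" for z
    using D[OF that] g int_trunc by (auto intro: integrable_real_mult_indicator)
  have min_g: "(\<integral>x. min (g x) b \<partial>M) = (1 - \<theta>) * G"
  proof -
    have "(\<integral>x. min (g x) b \<partial>M) = (\<integral>x. g x - max 0 (g x - b) \<partial>M)"
      by (intro Bochner_Integration.integral_cong) (auto simp: min_def max_def)
    also have "\<dots> = G - \<theta> * G"
      by (simp add: int_trunc g b(2) G_def)
    finally show ?thesis by (simp add: algebra_simps)
  qed
  have min_\<beta>: "(\<Sum>z\<in>Z. min (\<beta> z) a) = (1 - \<theta>) * B"
  proof -
    have "(\<Sum>z\<in>Z. min (\<beta> z) a) = (\<Sum>z\<in>Z. \<beta> z - max 0 (\<beta> z - a))"
      by (intro sum.cong) (auto simp: min_def max_def)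
    then show ?thesis by (simp add: sum_subtractf a(2) B_def algebra_simps)
  qed
  \<comment> \<open>Truncation accounts for \<open>\<sigma> / 2\<close> of the loss and the
    mismatch, at most \<open>2 * \<zeta> / \<epsilon>\<close>, for
    \<open>\<sigma> / 4\<close>.\<close>
  have K': "p - 3 / 4 * \<sigma> \<le> K'"
  proof -
    have "(\<Sum>z\<in>Z. min (\<beta> z) a * ((1 - \<theta>) * G) - \<beta> z * (\<integral>x. g x * indicator (D z) x \<partial>M) / \<epsilon>) \<le> K'"
      unfolding K'_def
    proof (rule sum_mono)
      fix z assume z: "z \<in> Z"
      have "(\<integral>x. min (g x) b * w z x \<partial>M)
          = (\<integral>x. min (g x) b - min (g x) b * indicator (D z) x / \<epsilon> \<partial>M)"
        by (simp add: w_def algebra_simps)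
      also have "\<dots> = (1 - \<theta>) * G - (\<integral>x. min (g x) b * indicator (D z) x \<partial>M) / \<epsilon>"
        by (subst Bochner_Integration.integral_diff) (auto simp: int_trunc int_gD z min_g)
      finally have 1: "(\<integral>x. min (g x) b * w z x \<partial>M)
        = (1 - \<theta>) * G - (\<integral>x. min (g x) b * indicator (D z) x \<partial>M) / \<epsilon>" .
      have "min (\<beta> z) a * (\<integral>x. min (g x) b * indicator (D z) x \<partial>M)
        \<le> \<beta> z * (\<integral>x. g x * indicator (D z) x \<partial>M)"
        using a b g \<beta> z int_gD
        by (intro mult_mono integral_mono integral_nonneg) (auto simp: indicator_def)
      then show "min (\<beta> z) a * ((1 - \<theta>) * G) - \<beta> z * (\<integral>x. g x * indicator (D z) x \<partial>M) / \<epsilon>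
        \<le> min (\<beta> z) a * (\<integral>x. min (g x) b * w z x \<partial>M)"
        using \<epsilon> unfolding 1 by (simp add: right_diff_distrib divide_right_mono)
    qed
    moreover have "(\<Sum>z\<in>Z. min (\<beta> z) a * ((1 - \<theta>) * G) - \<beta> z * (\<integral>x. g x * indicator (D z) x \<partial>M) / \<epsilon>)
      = (1 - \<theta>) * B * ((1 - \<theta>) * G) - (\<Sum>z\<in>Z. \<beta> z * (\<integral>x. g x * indicator (D z) x \<partial>M)) / \<epsilon>"
      by (simp add: sum_subtractf sum_divide_distrib min_\<beta>[symmetric] sum_distrib_right)
    moreover have "(\<Sum>z\<in>Z. \<beta> z * (\<integral>x. g x * indicator (D z) x \<partial>M)) / \<epsilon> \<le> 2 * \<zeta> / \<epsilon>"
      using mismatch \<epsilon> by (intro divide_right_mono) auto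
    moreover have "2 * \<zeta> / \<epsilon> \<le> \<sigma> / 4"
      using \<zeta>(1) \<epsilon> by (simp add: field_simps)
    moreover have "p - \<sigma> / 2 \<le> (1 - \<theta>) * B * ((1 - \<theta>) * G)"
    proof -
      have "(1 - \<theta>) * B * ((1 - \<theta>) * G) = p - 2 * \<theta> * p + \<theta>^2 * p"
        by (simp add: pBG power2_eq_square algebra_simps)
      moreover have "2 * \<theta> * p \<le> 2 * \<theta> * 2" using \<theta> p by (intro mult_left_mono) auto
      moreover have "0 \<le> \<theta>^2 * p" using p \<sigma> by simp
      ultimately show ?thesis by (simp add: \<theta>_def)
    qed
    ultimately show ?thesis by linarith
  qed

  have int_w: "integrable M (\<lambda>x. h x * w z x)" if "z \<in> Z" "integrable M h" for z h
    using that integrable_real_mult_indicator[OF D that(2), of z] unfolding w_def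
    by (simp add: right_diff_distrib)
  \<comment> \<open>The levels are chosen one after the other: first one for \<open>g\<close>, with
    the \<open>\<beta>\<close>-weighted sum as weight, then one for \<open>\<beta>\<close>, with the
    integrals over \<open>E\<close> as weight.\<close>
  obtain s where s: "(\<integral>x. min (g x) b * (\<Sum>z\<in>Z. min (\<beta> z) a * w z x) \<partial>M)
    \<le> b * (\<integral>x. indicator {y. s < g y} x * (\<Sum>z\<in>Z. min (\<beta> z) a * w z x) \<partial>M)"
    using ex_level_set_ge_average[of g "\<lambda>x. \<Sum>z\<in>Z. min (\<beta> z) a * w z x" b]
      g b int_w[of _ "\<lambda>_. 1"] by auto
  define E where "E = {x \<in> space M. s < g x}"
  have [measurable]: "E \<in> sets M" unfolding E_def using g(1) by measurable
  have int_E: "integrable M (\<lambda>x. indicator E x * w z x)" if "z \<in> Z" for z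
    using that by (intro int_w) (auto simp: emeasure_eq_measure)
  define v where "v z = (\<integral>x. indicator E x * w z x \<partial>M)" for z
  have K'_le: "K' \<le> b * (\<Sum>z\<in>Z. min (\<beta> z) a * v z)"
  proof -
    have "K' = (\<integral>x. min (g x) b * (\<Sum>z\<in>Z. min (\<beta> z) a * w z x) \<partial>M)"
      unfolding K'_def sum_distrib_left
      by (subst Bochner_Integration.integral_sum)
         (auto simp: int_w int_trunc mult.left_commute[of "min (g _) b"])
    also note s
    also have "(\<integral>x. indicator {y. s < g y} x * (\<Sum>z\<in>Z. min (\<beta> z) a * w z x) \<partial>M)
      = (\<integral>x. indicator E x * (\<Sum>z\<in>Z. min (\<beta> z) a * w z x) \<partial>M)"
      by (intro Bochner_Integration.integral_cong) (auto simp: E_def indicator_def)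
    also have "\<dots> = (\<Sum>z\<in>Z. min (\<beta> z) a * v z)"
      unfolding v_def sum_distrib_left
      by (subst Bochner_Integration.integral_sum)
         (auto simp: int_E mult.left_commute[of "indicator E _"])
    finally show ?thesis .
  qed
  obtain u where u: "(\<Sum>z\<in>Z. min (\<beta> z) a * v z) \<le> a * (\<Sum>z\<in>Z. indicator {z. u < \<beta> z} z * v z)"
    using Z.ex_level_set_ge_average[of \<beta> v a] a \<beta> Z
    by (auto simp: lebesgue_integral_count_space_finite integrable_count_space)
  define \<Lambda> where "\<Lambda> = {z\<in>Z. u < \<beta> z}"
  have \<Lambda>: "\<Lambda> \<subseteq> Z" "finite \<Lambda>" using Z by (auto simp: \<Lambda>_def)
  have "(\<Sum>z\<in>Z. indicator {z. u < \<beta> z} z * v z) = sum v \<Lambda>"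
    unfolding \<Lambda>_def using Z by (intro sum.mono_neutral_cong_right) auto
  then have "b * (\<Sum>z\<in>Z. min (\<beta> z) a * v z) \<le> b * (a * sum v \<Lambda>)"
    using u b by (intro mult_left_mono) auto
  with K'_le have K'_le_v: "K' \<le> (a * b) * sum v \<Lambda>" by (simp add: ac_simps)
  moreover have "0 < K'" using K' p \<sigma> by simp
  ultimately have "0 < a * b * sum v \<Lambda>" by linarith
  \<comment> \<open>Only for a positive sum does \<open>a * b < 1\<close> allow the factor
    \<open>a * b\<close> to be dropped.\<close>
  then have "0 < sum v \<Lambda>" using ab(1) by (rule zero_less_mult_pos)
  then have "(a * b) * sum v \<Lambda> \<le> 1 * sum v \<Lambda>" using ab by (intro mult_right_mono) auto
  with K'_le_v K' have v_ge: "p - 3 / 4 * \<sigma> \<le> sum v \<Lambda>" by simp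

  have int_ED: "integrable M (\<lambda>x. indicator E x * w z x)" if "z \<in> \<Lambda>" for z
    using that \<Lambda> by (intro int_E) auto
  \<comment> \<open>Every position contributes at most \<open>\<kappa>\<close>, so many positions are needed.\<close>
  have "sum v \<Lambda> \<le> (\<Sum>z\<in>\<Lambda>. \<kappa>)"
  proof (rule sum_mono)
    fix z assume "z \<in> \<Lambda>"
    then have z: "z \<in> Z" using \<Lambda> by auto
    have "v z \<le> (\<integral>x. indicator (space M - D z) x \<partial>M)"
      unfolding v_def
    proof (rule integral_mono)
      \<comment> \<open>On \<open>D z\<close> the weight is \<open>1 - 1 / \<epsilon>\<close>, which
        is not positive because \<open>\<epsilon> \<le> 1\<close>.\<close>
      show "indicator E x * w z x \<le> indicator (space M - D z) x" if "x \<in> space M" for x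
        using \<epsilon> that by (auto simp: w_def indicator_def)
    qed (use int_ED \<open>z \<in> \<Lambda>\<close> D z in \<open>auto simp: emeasure_eq_measure\<close>)
    also have "\<dots> \<le> \<kappa>" using small[OF z] by (simp add: Int_absorb2)
    finally show "v z \<le> \<kappa>" .
  qed
  with v_ge p have "\<sigma> / 4 < real (card \<Lambda>) * \<kappa>" by simp
  moreover have "\<kappa> * real K \<le> \<sigma> / 4" using \<kappa> by simp
  ultimately have "\<kappa> * real K < \<kappa> * real (card \<Lambda>)" by (simp add: mult.commute)
  then have card: "K \<le> card \<Lambda>" using \<kappa> by simp

  define A where "A = {x \<in> space M. real (card {z\<in>\<Lambda>. x \<in> D z}) < \<epsilon> * real (card \<Lambda>)}"
  have card_sum: "real (card {z\<in>\<Lambda>. x \<in> D z}) = (\<Sum>z\<in>\<Lambda>. indicator (D z) x)" for x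
    using \<Lambda> by (simp add: indicator_def sum.If_cases Int_def)
  have [measurable]: "A \<in> sets M"
  proof -
    have "(\<lambda>x. \<Sum>z\<in>\<Lambda>. indicator (D z) x :: real) \<in> borel_measurable M"
      using \<Lambda> D by (intro borel_measurable_sum borel_measurable_indicator) auto
    then show ?thesis unfolding A_def card_sum by measurable
  qed
  have "sum v \<Lambda> = (\<integral>x. (\<Sum>z\<in>\<Lambda>. indicator E x * w z x) \<partial>M)"
    unfolding v_def using int_ED by (subst Bochner_Integration.integral_sum) auto
  also have "\<dots> \<le> (\<integral>x. real (card \<Lambda>) * indicator A x \<partial>M)"
  proof (rule integral_mono)
    fix x assume x: "x \<in> space M"
    have eq: "(\<Sum>z\<in>\<Lambda>. indicator E x * w z x)
      = indicator E x * (real (card \<Lambda>) - real (card {z\<in>\<Lambda>. x \<in> D z}) / \<epsilon>)"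
      unfolding card_sum w_def
      by (simp add: sum_distrib_left[symmetric] sum_subtractf sum_divide_distrib[symmetric])
    show "(\<Sum>z\<in>\<Lambda>. indicator E x * w z x) \<le> real (card \<Lambda>) * indicator A x"
    proof (cases "x \<in> A")
      case True
      then show ?thesis unfolding eq using \<epsilon> by (auto simp: indicator_def)
    next
      case False
      then have "\<epsilon> * real (card \<Lambda>) \<le> real (card {z\<in>\<Lambda>. x \<in> D z})" using x by (auto simp: A_def)
      then have "real (card \<Lambda>) \<le> real (card {z\<in>\<Lambda>. x \<in> D z}) / \<epsilon>" using \<epsilon> by (simp add: field_simps)
      then show ?thesis unfolding eq using False by (auto simp: indicator_def)
    qed
  qed (use int_ED in \<open>auto simp: emeasure_eq_measure\<close>)
  also have "\<dots> = real (card \<Lambda>) * prob A" by simp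
  finally have "p - \<sigma> \<le> real (card \<Lambda>) * prob A" using v_ge \<sigma> by linarith
  with \<Lambda> card show ?thesis unfolding A_def by blast
qed

section \<open>Towers from the AT(n) approximation\<close>

text \<open>The map sending \<open>t\<close> to \<open>max 0 (t - 1)\<close> is superadditive on
  nonnegative reals. This bounds the excess of single translates by the excess of their sum.\<close>

lemma sum_excess_le:
  fixes f :: "'a \<Rightarrow> real"
  assumes "finite A" "\<And>z. z \<in> A \<Longrightarrow> 0 \<le> f z"
  shows "(\<Sum>z\<in>A. max 0 (f z - 1)) \<le> max 0 (sum f A - 1)"
  using assms
proof (induction A rule: finite_induct)
  case (insert z A)
  then have "0 \<le> sum f A" "0 \<le> f z" by (auto intro: sum_nonneg)
  moreover have "(\<Sum>z\<in>A. max 0 (f z - 1)) \<le> max 0 (sum f A - 1)"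
    using insert by auto
  moreover have "max 0 (f z - 1) + max 0 (sum f A - 1) \<le> max 0 (f z + sum f A - 1)"
    using calculation(1,2) by auto
  ultimately show ?case using insert.hyps by simp
qed simp

text \<open>The theorem for an arbitrary coding \<open>c\<close> with small cells. Points
  \<open>x\<close> weighted by \<open>g m (U z x)\<close> mostly have the name \<open>V m z\<close>;
  with \<open>y = U z x\<close>, points \<open>y\<close> weighted by \<open>g m y\<close> have this
  name at \<open>U (- z) y\<close>, whence the sign in the conclusion.\<close>

lemma (in prob_space) AT_ex_towers:
  fixes T :: "'a \<Rightarrow> 'a" and c :: "'a \<Rightarrow> nat"
  defines "U \<equiv> int_iterate M T"
  assumes AT: "AT n M T"
    and U: "\<And>z. U z \<in> measurable M M" "\<And>z. distr M M (U z) = M"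
      "\<And>z x. x \<in> space M \<Longrightarrow> U (- z) (U z x) = x"
    and c [measurable]: "c \<in> measurable M (count_space UNIV)"
    and c_range: "\<And>x. x \<in> space M \<Longrightarrow> c x \<in> {1..r}"
    and small: "\<And>i. i \<in> {1..r} \<Longrightarrow> prob {x \<in> space M. c x = i} \<le> \<kappa>"
    and \<kappa>: "0 < \<kappa>" "4 * \<kappa> * real K \<le> \<sigma>"
    and \<epsilon>: "0 < \<epsilon>" "\<epsilon> \<le> 1" and \<sigma>: "0 < \<sigma>"
  shows "\<exists>(\<Lambda> :: nat \<Rightarrow> int set) (V :: nat \<Rightarrow> int \<Rightarrow> nat).
    (\<forall>m\<in>{1..n}. finite (\<Lambda> m) \<and> K \<le> card (\<Lambda> m) \<and> (\<forall>z. V m z \<in> {1..r})) \<and>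
    1 - real (n + 1) * \<sigma> < (\<Sum>m=1..n. real (card (\<Lambda> m)) *
      prob {x \<in> space M. real (card {z\<in>\<Lambda> m. c (U (- z) x) \<noteq> V m z}) < \<epsilon> * real (card (\<Lambda> m))})"
proof -
  note [measurable] = U(1)
  obtain x0 where "x0 \<in> space M" using not_empty by blast
  then have r: "1 \<le> r" using c_range by fastforce
  \<comment> \<open>The first two entries serve the construction of a tower,
    \<open>\<sigma> / 2\<close> gives the strict final inequality, and 1 keeps every
    \<open>p m\<close> at most 2. The halvings make bounds strict.\<close>
  define \<zeta> where "\<zeta> = Min {\<epsilon> * \<sigma> / 8, \<sigma> ^ 3 / 128, \<sigma> / 2, 1}"
  have \<zeta>: "0 < \<zeta>" "8 * \<zeta> \<le> \<epsilon> * \<sigma>" "64 * \<zeta> < \<sigma> ^ 3" "\<zeta> < \<sigma>" "\<zeta> \<le> 1"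
  proof -
    show "0 < \<zeta>" unfolding \<zeta>_def using \<epsilon> \<sigma> by (subst Min_gr_iff) auto
    have "\<zeta> \<le> \<epsilon> * \<sigma> / 8" "\<zeta> \<le> \<sigma> ^ 3 / 128" "\<zeta> \<le> \<sigma> / 2" "\<zeta> \<le> 1"
      unfolding \<zeta>_def by (auto intro!: Min_le)
    moreover have "0 < \<sigma> ^ 3" using \<sigma> by simp
    ultimately show "8 * \<zeta> \<le> \<epsilon> * \<sigma>" "64 * \<zeta> < \<sigma> ^ 3" "\<zeta> < \<sigma>" "\<zeta> \<le> 1"
      using \<sigma> by linarith+
  qed
  \<comment> \<open>The errors of the \<open>r\<close> cells then add up to at most
    \<open>\<zeta>\<close>.\<close>
  define \<eta> where "\<eta> = \<zeta> / real r"
  define f where "f i x = (indicator {i} (c x) :: real)" for i x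
  have f_meas [measurable]: "f i \<in> borel_measurable M" for i
    unfolding f_def by (rule measurable_compose[OF c]) simp
  have f_int: "integrable M (f i)" for i
    by (rule integrable_const_bound[of _ 1]) (auto simp: f_def indicator_def)
  have "f i \<in> L1_nonneg M" for i
    using f_int by (auto simp: L1_nonneg_def f_def)
  moreover have "0 < \<eta>" using \<zeta> r by (simp add: \<eta>_def)
  ultimately obtain g0 :: "nat \<Rightarrow> 'a \<Rightarrow> real" and N :: nat
      and \<alpha> :: "nat \<Rightarrow> nat \<Rightarrow> nat \<Rightarrow> real" and t :: "nat \<Rightarrow> nat \<Rightarrow> int" where
    g0: "\<And>m. m \<in> {1..n} \<Longrightarrow> g0 m \<in> L1_nonneg M" and
    \<alpha>: "\<And>m i j. m \<in> {1..n} \<Longrightarrow> i \<in> {1..r} \<Longrightarrow> j \<in> {1..N} \<Longrightarrow> \<alpha> m i j \<ge> 0" and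
    approx0: "\<And>i. i \<in> {1..r} \<Longrightarrow> L1_norm M (\<lambda>x. f i x -
                (\<Sum>m=1..n. \<Sum>j=1..N. \<alpha> m i j * g0 m (U (t m j) x))) < \<eta>"
    using AT[unfolded AT_def, rule_format, of \<eta> r f] unfolding U_def by blast
  \<comment> \<open>Members of \<open>L1_nonneg\<close> are nonnegative only almost everywhere;
    clipping makes this hold at every point.\<close>
  define g where "g m x = max 0 (g0 m x)" for m x
  have g_nn: "0 \<le> g m x" for m x by (simp add: g_def)
  have g_int: "integrable M (g m)" if "m \<in> {1..n}" for m
    using g0[OF that] unfolding g_def L1_nonneg_def by simp
  have gU_int: "integrable M (\<lambda>x. g m (U z x))" if "m \<in> {1..n}" for m z
    using g_int[OF that] integrable_distr_eq[OF U(1), of "g m" z] U(2)[of z] by auto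
  have U_integral: "(\<integral>x. h (U z x) \<partial>M) = (\<integral>x. h x \<partial>M)" if "h \<in> borel_measurable M"
    for h :: "'a \<Rightarrow> real" and z
    using integral_distr[OF U(1) that, of z] U(2)[of z] by simp
  define Z where "Z m = t m ` {1..N}" for m
  have Z: "finite (Z m)" for m by (simp add: Z_def)
  define \<beta> where "\<beta> m i z = (\<Sum>j | j \<in> {1..N} \<and> t m j = z. \<alpha> m i j)" for m i z
  have \<beta>_nn: "0 \<le> \<beta> m i z" if "m \<in> {1..n}" "i \<in> {1..r}" for m i z
    unfolding \<beta>_def using \<alpha> that by (intro sum_nonneg) auto
  define F where "F i x = (\<Sum>m=1..n. \<Sum>z\<in>Z m. \<beta> m i z * g m (U z x))" for i x
  have F_int: "integrable M (F i)" for i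
    unfolding F_def using gU_int by (intro Bochner_Integration.integrable_sum) auto
  \<comment> \<open>The times \<open>t m j\<close> may repeat, hence the regrouping by their values.\<close>
  have F_eq: "AE x in M. \<forall>i. (\<Sum>m=1..n. \<Sum>j=1..N. \<alpha> m i j * g0 m (U (t m j) x)) = F i x"
  proof -
    have "AE x in M. \<forall>m\<in>{1..n}. \<forall>z. 0 \<le> g0 m (U z x)"
    proof (intro AE_ball_countable[THEN iffD2] ballI AE_all_countable[THEN iffD2] allI)
      fix m z assume "m \<in> {1..n}"
      then have "AE x in distr M M (U z). 0 \<le> g0 m x"
        unfolding U(2) using g0[of m] by (simp add: L1_nonneg_def)
      then show "AE x in M. 0 \<le> g0 m (U z x)" by (rule AE_distrD[OF U(1)])
    qed auto
    then show ?thesis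
    proof eventually_elim
      case (elim x)
      show ?case
      proof
        fix i
        have "(\<Sum>j=1..N. \<alpha> m i j * g0 m (U (t m j) x)) = (\<Sum>z\<in>Z m. \<beta> m i z * g m (U z x))"
          if "m \<in> {1..n}" for m
        proof -
          have "(\<Sum>j=1..N. \<alpha> m i j * g0 m (U (t m j) x))
            = (\<Sum>z\<in>Z m. \<Sum>j | j \<in> {1..N} \<and> t m j = z. \<alpha> m i j * g0 m (U (t m j) x))"
            unfolding Z_def by (rule sum.image_gen) simp
          also have "\<dots> = (\<Sum>z\<in>Z m. \<Sum>j | j \<in> {1..N} \<and> t m j = z. \<alpha> m i j * g m (U z x))"
            using elim that by (intro sum.cong) (auto simp: g_def)
          finally show ?thesis by (simp add: \<beta>_def sum_distrib_right)
        qed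
        then show "(\<Sum>m=1..n. \<Sum>j=1..N. \<alpha> m i j * g0 m (U (t m j) x)) = F i x"
          unfolding F_def by (intro sum.cong) auto
      qed
    qed
  qed
  have approx: "(\<integral>x. \<bar>f i x - F i x\<bar> \<partial>M) \<le> \<eta>" if "i \<in> {1..r}" for i
  proof -
    have [measurable]: "(\<lambda>x. g0 m (U z x)) \<in> borel_measurable M" if "m \<in> {1..n}" for m z
      using g0[OF that] by (intro measurable_compose[OF U(1)]) (auto simp: L1_nonneg_def)
    have "(\<integral>x. \<bar>f i x - F i x\<bar> \<partial>M) = L1_norm M (\<lambda>x. f i x -
                (\<Sum>m=1..n. \<Sum>j=1..N. \<alpha> m i j * g0 m (U (t m j) x)))"
      unfolding L1_norm_def
    proof (rule integral_cong_AE)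
      show "(\<lambda>x. \<bar>f i x - F i x\<bar>) \<in> borel_measurable M" using F_int[of i] by simp
      show "(\<lambda>x. \<bar>f i x - (\<Sum>m=1..n. \<Sum>j=1..N. \<alpha> m i j * g0 m (U (t m j) x))\<bar>) \<in> borel_measurable M"
        by measurable
      show "AE x in M. \<bar>f i x - F i x\<bar> = \<bar>f i x - (\<Sum>m=1..n. \<Sum>j=1..N. \<alpha> m i j * g0 m (U (t m j) x))\<bar>"
        using F_eq by eventually_elim simp
    qed
    with approx0[OF that] show ?thesis by simp
  qed
  \<comment> \<open>The total pointwise error, of integral at most \<open>\<zeta>\<close>; it
    dominates the deviation of \<open>S\<close> from 1, the excess and, up to a factor 2, the
    mismatch.\<close>
  define H where "H x = (\<Sum>i=1..r. \<bar>f i x - F i x\<bar>)" for x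
  have H_int: "integrable M H"
    unfolding H_def using f_int F_int by (intro Bochner_Integration.integrable_sum) auto
  have H_le: "(\<integral>x. H x \<partial>M) \<le> \<zeta>"
  proof -
    have "(\<integral>x. H x \<partial>M) = (\<Sum>i=1..r. \<integral>x. \<bar>f i x - F i x\<bar> \<partial>M)"
      unfolding H_def using f_int F_int by (intro Bochner_Integration.integral_sum) auto
    also have "\<dots> \<le> (\<Sum>i=1..r. \<eta>)" using approx by (intro sum_mono) auto
    also have "\<dots> = \<zeta>" using r by (simp add: \<eta>_def)
    finally show ?thesis .
  qed
  define b where "b m z = (\<Sum>i=1..r. \<beta> m i z)" for m z
  have b_nn: "0 \<le> b m z" if "m \<in> {1..n}" for m z
    unfolding b_def using \<beta>_nn that by (intro sum_nonneg) auto
  have F_ge: "(\<Sum>z\<in>Z m. \<beta> m i z * g m (U z x)) \<le> F i x" if "m \<in> {1..n}" "i \<in> {1..r}" for m i x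
    unfolding F_def using that \<beta>_nn g_nn
    by (intro member_le_sum[of m "{1..n}" "\<lambda>m. \<Sum>z\<in>Z m. \<beta> m i z * g m (U z x)"] sum_nonneg) auto
  define S where "S x = (\<Sum>i=1..r. F i x)" for x
  have S_eq: "S x = (\<Sum>m=1..n. \<Sum>z\<in>Z m. b m z * g m (U z x))" for x
    unfolding S_def F_def b_def sum_distrib_right
    by (subst sum.swap) (intro sum.cong refl sum.swap)
  have S_int: "integrable M S"
    unfolding S_def using F_int by (intro Bochner_Integration.integrable_sum) auto
  have S_H: "\<bar>S x - 1\<bar> \<le> H x" if "x \<in> space M" for x
  proof -
    have "(\<Sum>i=1..r. f i x) = (\<Sum>i=1..r. if c x = i then 1 else 0)"
      by (intro sum.cong) (auto simp: f_def)
    also have "\<dots> = 1" using c_range[OF that] by simp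
    finally have "(\<Sum>i=1..r. f i x) = 1" .
    then have "\<bar>S x - 1\<bar> = \<bar>\<Sum>i=1..r. f i x - F i x\<bar>" by (simp add: S_def sum_subtractf)
    also have "\<dots> \<le> H x" unfolding H_def by (rule sum_abs)
    finally show ?thesis .
  qed
  define p where "p m = sum (b m) (Z m) * (\<integral>x. g m x \<partial>M)" for m
  have p_nn: "0 \<le> p m" if "m \<in> {1..n}" for m
    unfolding p_def using b_nn[OF that] g_nn by (intro mult_nonneg_nonneg sum_nonneg integral_nonneg) auto
  have sum_p: "(\<Sum>m=1..n. p m) = (\<integral>x. S x \<partial>M)"
  proof -
    have "(\<integral>x. S x \<partial>M) = (\<Sum>m=1..n. \<Sum>z\<in>Z m. b m z * (\<integral>x. g m (U z x) \<partial>M))"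
      unfolding S_eq using gU_int by (simp add: Bochner_Integration.integral_sum)
    also have "\<dots> = (\<Sum>m=1..n. \<Sum>z\<in>Z m. b m z * (\<integral>x. g m x \<partial>M))"
      using g_int by (intro sum.cong refl arg_cong2[of _ _ _ _ "(*)"] U_integral) auto
    finally show ?thesis by (simp add: p_def sum_distrib_right)
  qed
  have "\<bar>(\<integral>x. S x \<partial>M) - 1\<bar> \<le> \<zeta>"
  proof -
    have "\<bar>(\<integral>x. S x \<partial>M) - 1\<bar> = \<bar>\<integral>x. S x - 1 \<partial>M\<bar>"
      using S_int by (simp add: prob_space)
    also have "\<dots> \<le> (\<integral>x. \<bar>S x - 1\<bar> \<partial>M)" by (rule integral_abs_bound)
    also have "\<dots> \<le> (\<integral>x. H x \<partial>M)" using S_int H_int S_H by (intro integral_mono) auto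
    finally show ?thesis using H_le by simp
  qed
  then have sum_p_bounds: "1 - \<zeta> \<le> (\<Sum>m=1..n. p m)" "(\<Sum>m=1..n. p m) \<le> 1 + \<zeta>"
    unfolding sum_p by auto
  have p_le: "p m \<le> 2" if "m \<in> {1..n}" for m
    using member_le_sum[of m "{1..n}" p] p_nn that sum_p_bounds \<zeta> by fastforce

  \<comment> \<open>The name at position \<open>z\<close> is a symbol of largest weight
    there.\<close>
  have "\<exists>V. \<forall>z. V z \<in> {1..r} \<and> (\<forall>i\<in>{1..r}. \<beta> m i z \<le> \<beta> m (V z) z)" for m
  proof (intro choice allI)
    fix z
    have "Max ((\<lambda>i. \<beta> m i z) ` {1..r}) \<in> (\<lambda>i. \<beta> m i z) ` {1..r}" using r by (intro Max_in) auto
    then obtain v where v: "v \<in> {1..r}" "\<beta> m v z = Max ((\<lambda>i. \<beta> m i z) ` {1..r})" by auto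
    then show "\<exists>v. v \<in> {1..r} \<and> (\<forall>i\<in>{1..r}. \<beta> m i z \<le> \<beta> m v z)" by (intro exI[of _ v]) auto
  qed
  then obtain V where V: "\<And>m z. V m z \<in> {1..r}"
      "\<And>m z i. i \<in> {1..r} \<Longrightarrow> \<beta> m i z \<le> \<beta> m (V m z) z"
    by metis

  have tower: "\<exists>\<Lambda>. finite \<Lambda> \<and> K \<le> card \<Lambda> \<and> p m - \<sigma> \<le> real (card \<Lambda>) *
      prob {x \<in> space M. real (card {z\<in>\<Lambda>. c (U (- z) x) \<noteq> V m z}) < \<epsilon> * real (card \<Lambda>)}"
    if m: "m \<in> {1..n}" for m
  proof (cases "\<sigma> < p m")
    case False
    \<comment> \<open>A family of mass at most \<open>\<sigma>\<close> demands nothing of the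
      measure, so any set of \<open>K\<close> positions will do.\<close>
    obtain \<Lambda> :: "int set" where "finite \<Lambda>" "card \<Lambda> = K"
      using infinite_arbitrarily_large[OF infinite_UNIV_int] by blast
    moreover have "p m - \<sigma> \<le> real (card \<Lambda>) * prob A" for A
      by (rule order_trans[of _ 0]) (use False in auto)
    ultimately show ?thesis by blast
  next
    case True
    define D where "D z = {x \<in> space M. c (U (- z) x) \<noteq> V m z}" for z
    have D [measurable]: "D z \<in> sets M" for z unfolding D_def by measurable
    have [measurable]: "g m \<in> borel_measurable M" using g_int[OF m] by simp
    have excess: "(\<Sum>z\<in>Z m. \<integral>x. max 0 (b m z * g m x - 1) \<partial>M) \<le> \<zeta>"
    proof -
      \<comment> \<open>Invariance moves each term to \<open>U z x\<close>, so that all translates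
        are evaluated at a common point, where their sum is at most \<open>S x\<close>.\<close>
      have "(\<Sum>z\<in>Z m. \<integral>x. max 0 (b m z * g m x - 1) \<partial>M)
        = (\<Sum>z\<in>Z m. \<integral>x. max 0 (b m z * g m (U z x) - 1) \<partial>M)"
        by (intro sum.cong refl U_integral[symmetric]) measurable
      also have "\<dots> = (\<integral>x. (\<Sum>z\<in>Z m. max 0 (b m z * g m (U z x) - 1)) \<partial>M)"
        using gU_int[OF m] by (subst Bochner_Integration.integral_sum) auto
      also have "\<dots> \<le> (\<integral>x. H x \<partial>M)"
      proof (rule integral_mono)
        fix x assume x: "x \<in> space M"
        have "(\<Sum>z\<in>Z m. max 0 (b m z * g m (U z x) - 1)) \<le> max 0 ((\<Sum>z\<in>Z m. b m z * g m (U z x)) - 1)"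
          using Z b_nn[OF m] g_nn by (intro sum_excess_le) auto
        also have "(\<Sum>z\<in>Z m. b m z * g m (U z x)) \<le> S x"
          unfolding S_eq using m b_nn g_nn
          by (intro member_le_sum[of m "{1..n}" "\<lambda>m. \<Sum>z\<in>Z m. b m z * g m (U z x)"] sum_nonneg) auto
        also have "max 0 (S x - 1) \<le> H x" using S_H[OF x] by auto
        finally show "(\<Sum>z\<in>Z m. max 0 (b m z * g m (U z x) - 1)) \<le> H x" by simp
      qed (use gU_int[OF m] H_int in auto)
      finally show ?thesis using H_le by simp
    qed
    have mismatch: "(\<Sum>z\<in>Z m. b m z * (\<integral>x. g m x * indicator (D z) x \<partial>M)) \<le> 2 * \<zeta>"
    proof -
      have int: "integrable M (\<lambda>x. g m (U z x) * indicator (D z) (U z x))" for z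
        using integrable_distr_eq[OF U(1), of "\<lambda>x. g m x * indicator (D z) x" z] U(2)[of z]
          integrable_real_mult_indicator[OF D g_int[OF m], of z] by auto
      have "(\<Sum>z\<in>Z m. b m z * (\<integral>x. g m x * indicator (D z) x \<partial>M))
        = (\<Sum>z\<in>Z m. b m z * (\<integral>x. g m (U z x) * indicator (D z) (U z x) \<partial>M))"
        by (intro sum.cong refl arg_cong2[of _ _ _ _ "(*)"] U_integral[symmetric]) measurable
      also have "\<dots> = (\<integral>x. (\<Sum>z\<in>Z m. b m z * (g m (U z x) * indicator (D z) (U z x))) \<partial>M)"
        using int by (subst Bochner_Integration.integral_sum) auto
      also have "\<dots> \<le> (\<integral>x. 2 * H x \<partial>M)"
      proof (rule integral_mono)
        fix x assume x: "x \<in> space M"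
        let ?I = "{1..r} - {c x}"
        have "(\<Sum>z\<in>Z m. b m z * (g m (U z x) * indicator (D z) (U z x)))
          \<le> (\<Sum>z\<in>Z m. 2 * (\<Sum>i\<in>?I. \<beta> m i z * g m (U z x)))"
        proof (rule sum_mono)
          fix z
          \<comment> \<open>If \<open>c x\<close> is not the heaviest name, then
            \<open>V m z\<close> lies in \<open>?I\<close>, and the weight of \<open>c x\<close> is
            at most that of \<open>V m z\<close>; hence at least half of \<open>b m z\<close> sits
            on wrong names.\<close>
          have "b m z * indicator (D z) (U z x) \<le> 2 * (\<Sum>i\<in>?I. \<beta> m i z)"
          proof (cases "c x = V m z")
            case True
            then show ?thesis
              using U(3)[OF x] \<beta>_nn[OF m] by (auto simp: D_def intro!: sum_nonneg)
          next
            case False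
            have "b m z = \<beta> m (c x) z + (\<Sum>i\<in>?I. \<beta> m i z)"
              unfolding b_def using c_range[OF x] by (intro sum.remove) auto
            moreover have "\<beta> m (c x) z \<le> \<beta> m (V m z) z" using V c_range[OF x] by auto
            moreover have "\<beta> m (V m z) z \<le> (\<Sum>i\<in>?I. \<beta> m i z)"
              using False V(1)[of m z] \<beta>_nn[OF m]
              by (intro member_le_sum[of "V m z" ?I "\<lambda>i. \<beta> m i z"]) auto
            moreover have "b m z * indicator (D z) (U z x) \<le> b m z"
              using b_nn[OF m] by (auto simp: indicator_def)
            ultimately show ?thesis by linarith
          qed
          then have "b m z * indicator (D z) (U z x) * g m (U z x) \<le> 2 * (\<Sum>i\<in>?I. \<beta> m i z) * g m (U z x)"
            using g_nn by (intro mult_right_mono) auto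
          then show "b m z * (g m (U z x) * indicator (D z) (U z x))
            \<le> 2 * (\<Sum>i\<in>?I. \<beta> m i z * g m (U z x))"
            by (simp add: ac_simps sum_distrib_left sum_distrib_right)
        qed
        also have "\<dots> = 2 * (\<Sum>i\<in>?I. \<Sum>z\<in>Z m. \<beta> m i z * g m (U z x))"
          unfolding sum_distrib_left[symmetric] by (subst sum.swap) simp
        also have "(\<Sum>i\<in>?I. \<Sum>z\<in>Z m. \<beta> m i z * g m (U z x)) \<le> (\<Sum>i\<in>?I. \<bar>f i x - F i x\<bar>)"
        proof (rule sum_mono)
          \<comment> \<open>Here \<open>f i x = 0\<close>, so all weight given to cell
            \<open>i\<close> at \<open>x\<close> is error.\<close>
          fix i assume "i \<in> ?I"
          with F_ge[OF m, of i x] show "(\<Sum>z\<in>Z m. \<beta> m i z * g m (U z x)) \<le> \<bar>f i x - F i x\<bar>"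
            by (auto simp: f_def)
        qed
        also have "\<dots> \<le> H x" unfolding H_def by (intro sum_mono2) auto
        finally show "(\<Sum>z\<in>Z m. b m z * (g m (U z x) * indicator (D z) (U z x))) \<le> 2 * H x" by simp
      qed (use int H_int in auto)
      finally show ?thesis using H_le by simp
    qed
    have small_D: "prob (space M - D z) \<le> \<kappa>" for z
    proof -
      have "space M - D z = U (- z) -` {x \<in> space M. c x = V m z} \<inter> space M"
        using measurable_space[OF U(1)] by (auto simp: D_def)
      then have "prob (space M - D z) = measure (distr M M (U (- z))) {x \<in> space M. c x = V m z}"
        by (simp add: measure_distr)
      then show ?thesis using small[OF V(1)[of m z]] by (simp add: U(2))
    qed
    obtain \<Lambda> where "\<Lambda> \<subseteq> Z m" "K \<le> card \<Lambda>" and *: "p m - \<sigma> \<le> real (card \<Lambda>) *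
        prob {x \<in> space M. real (card {z\<in>\<Lambda>. x \<in> D z}) < \<epsilon> * real (card \<Lambda>)}"
      using ex_tower[OF g_int[OF m] g_nn Z b_nn[OF m] D excess mismatch small_D p_def True p_le[OF m]
          \<epsilon> \<sigma> \<zeta>(2,3) \<kappa>] by blast
    have "{x \<in> space M. real (card {z\<in>\<Lambda>. x \<in> D z}) < \<epsilon> * real (card \<Lambda>)}
      = {x \<in> space M. real (card {z\<in>\<Lambda>. c (U (- z) x) \<noteq> V m z}) < \<epsilon> * real (card \<Lambda>)}"
      by (auto simp: D_def)
    with * have "p m - \<sigma> \<le> real (card \<Lambda>) *
        prob {x \<in> space M. real (card {z\<in>\<Lambda>. c (U (- z) x) \<noteq> V m z}) < \<epsilon> * real (card \<Lambda>)}" by simp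
    with finite_subset[OF \<open>\<Lambda> \<subseteq> Z m\<close> Z] \<open>K \<le> card \<Lambda>\<close> show ?thesis by blast
  qed
  then have "\<forall>m\<in>{1..n}. \<exists>\<Lambda>. finite \<Lambda> \<and> K \<le> card \<Lambda> \<and> p m - \<sigma> \<le> real (card \<Lambda>) *
      prob {x \<in> space M. real (card {z\<in>\<Lambda>. c (U (- z) x) \<noteq> V m z}) < \<epsilon> * real (card \<Lambda>)}"
    by (rule ballI)
  from bchoice[OF this] obtain \<Lambda> where \<Lambda>: "\<forall>m\<in>{1..n}. finite (\<Lambda> m) \<and> K \<le> card (\<Lambda> m) \<and> p m - \<sigma> \<le> real (card (\<Lambda> m)) *
      prob {x \<in> space M. real (card {z\<in>\<Lambda> m. c (U (- z) x) \<noteq> V m z}) < \<epsilon> * real (card (\<Lambda> m))}"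
    by (rule exE)
  \<comment> \<open>Each of the \<open>n\<close> towers costs one \<open>\<sigma>\<close>; the last
    one absorbs \<open>\<zeta> < \<sigma>\<close>, since the masses \<open>p m\<close> sum to at
    least \<open>1 - \<zeta>\<close>.\<close>
  have "1 - real (n + 1) * \<sigma> < (\<Sum>m=1..n. p m - \<sigma>)"
    using sum_p_bounds \<zeta> by (simp add: sum_subtractf algebra_simps)
  also have "\<dots> \<le> (\<Sum>m=1..n. real (card (\<Lambda> m)) *
      prob {x \<in> space M. real (card {z\<in>\<Lambda> m. c (U (- z) x) \<noteq> V m z}) < \<epsilon> * real (card (\<Lambda> m))})"
    using \<Lambda> by (intro sum_mono) auto
  finally show ?thesis using \<Lambda> V(1) by (intro exI[of _ \<Lambda>] exI[of _ V]) auto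
qed

section \<open>Iterates of the shift as translations\<close>

lemma measurable_translation:
  assumes "sets \<nu> = sets (full_shift_space k)"
  shows "(\<lambda>x i. x (i + z)) \<in> measurable \<nu> \<nu>"
proof -
  have "(\<lambda>x i. x (i + z)) \<in> measurable (full_shift_space k) (full_shift_space k)"
    unfolding full_shift_space_def
    by (rule measurable_PiM_single')
       (auto simp: space_PiM PiE_def Pi_def intro!: measurable_component_singleton)
  then show ?thesis using measurable_cong_sets[OF assms assms] by simp
qed

lemma measurable_coordinate:
  assumes "sets \<nu> = sets (full_shift_space k)"
  shows "(\<lambda>x. x i) \<in> measurable \<nu> (count_space UNIV)"
proof -
  have "(\<lambda>x. x i) \<in> measurable (full_shift_space k) (count_space {1..k})"
    unfolding full_shift_space_def by (rule measurable_component_singleton) simp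
  then have "(\<lambda>x. x i) \<in> measurable (full_shift_space k) (count_space UNIV)"
    by (rule measurable_compose) simp
  then show ?thesis by (subst measurable_cong_sets[OF assms refl])
qed

lemma int_iterate_shift_map:
  assumes "sets \<nu> = sets (full_shift_space k)" and x: "x \<in> space \<nu>"
  shows "int_iterate \<nu> shift_map z x = (\<lambda>i. x (i + z))"
proof -
  have sp: "space \<nu> = {x. \<forall>n. x n \<in> {1..k}}"
    using sets_eq_imp_space_eq[OF assms(1)] by (simp add: space_full_shift_space)
  have inj: "inj_on shift_map (space \<nu>)"
  proof (rule inj_onI, rule ext)
    fix x y :: "int \<Rightarrow> nat" and n assume "shift_map x = shift_map y"
    then have "shift_map x (n - 1) = shift_map y (n - 1)" by simp
    then show "x n = y n" by (simp add: shift_map_def)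
  qed
  have inv: "the_inv_into (space \<nu>) shift_map y = (\<lambda>i. y (i - 1))" if "y \<in> space \<nu>" for y
    by (rule the_inv_into_f_eq[OF inj]) (use that in \<open>auto simp: sp shift_map_def\<close>)
  have pos: "(shift_map ^^ j) x = (\<lambda>i. x (i + int j))" for j
    by (induction j) (auto simp: shift_map_def algebra_simps)
  have neg: "(the_inv_into (space \<nu>) shift_map ^^ j) x = (\<lambda>i. x (i - int j))" for j
  proof (induction j)
    case (Suc j)
    \<comment> \<open>The inverse is known only on \<open>space \<nu>\<close>, so the iterates must
      stay there.\<close>
    have "(\<lambda>i. x (i - int j)) \<in> space \<nu>" using x by (simp add: sp)
    with Suc show ?case by (simp add: inv algebra_simps)
  qed simp
  show ?thesis by (simp add: int_iterate_def pos neg)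
qed

lemma distr_translation:
  assumes sets: "sets \<nu> = sets (full_shift_space k)" and inv: "distr \<nu> \<nu> shift_map = \<nu>"
  shows "distr \<nu> \<nu> (\<lambda>x i. x (i + z)) = \<nu>"
proof -
  note meas = measurable_translation[OF sets]
  have comp: "distr (distr \<nu> \<nu> (\<lambda>x i. x (i + a))) \<nu> (\<lambda>x i. x (i + b)) = distr \<nu> \<nu> (\<lambda>x i. x (i + (b + a)))"
    for a b
    by (subst distr_distr[OF meas meas]) (simp add: comp_def add.assoc)
  have nat: "distr \<nu> \<nu> (\<lambda>x i. x (i + int j)) = \<nu>" for j
  proof (induction j)
    case 0
    then show ?case by (simp add: distr_id)
  next
    case (Suc j)
    then show ?case
      using comp[of "int j" 1] inv by (simp add: shift_map_def[abs_def])
  qed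
  show ?thesis
  proof (cases "0 \<le> z")
    case True
    then show ?thesis using nat[of "nat z"] by simp
  next
    case False
    \<comment> \<open>Pushing the invariance under translation by \<open>- z\<close> forward by
      \<open>z\<close> composes to the identity.\<close>
    then show ?thesis using comp[of "- z" z] nat[of "nat (- z)"] by (simp add: distr_id)
  qed
qed

section \<open>Small cells for a non-atomic measure\<close>

lemma nonatomic_singleton:
  assumes "nonatomic M" "{x} \<in> sets M"
  shows "emeasure M {x} = 0"
proof (rule ccontr)
  assume "emeasure M {x} \<noteq> 0"
  then have "0 < emeasure M {x}" by (simp add: zero_less_iff_neq_zero)
  then obtain B where "B \<subseteq> {x}" "0 < emeasure M B" "emeasure M B < emeasure M {x}"
    using assms unfolding nonatomic_def by blast
  then show False by (auto simp: subset_singleton_iff)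
qed

text \<open>The squares of the measures of the cylinders over \<open>{-L..L}\<close> are at most the product measure of
  the pairs that agree on \<open>{-L..L}\<close>, and these pairs decrease to the diagonal, a null set.\<close>

lemma ex_window_small_cylinders:
  assumes "prob_space \<nu>" and sets: "sets \<nu> = sets (full_shift_space k)" and "nonatomic \<nu>"
    and \<kappa>: "0 < \<kappa>"
  shows "\<exists>L::nat. \<forall>w. measure \<nu> {x\<in>space \<nu>. \<forall>i\<in>{- int L..int L}. x i = w i} \<le> \<kappa>"
proof -
  interpret prob_space \<nu> by fact
  interpret P: pair_prob_space \<nu> \<nu> ..
  note coord [measurable] = measurable_coordinate[OF sets]
  define E where "E L = {p \<in> space (\<nu> \<Otimes>\<^sub>M \<nu>). \<forall>i\<in>{- int L..int L}. fst p i = snd p i}" for L :: nat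
  have E_meas: "E L \<in> P.events" for L
    unfolding E_def
  proof (intro sets.sets_Collect_finite_All)
    fix i
    have "(\<lambda>x. x i) \<in> borel_measurable \<nu>" using coord by (rule measurable_compose) simp
    then show "{p \<in> space (\<nu> \<Otimes>\<^sub>M \<nu>). fst p i = snd p i} \<in> P.events"
      by (intro measurable_equality_set measurable_compose[OF measurable_fst]
          measurable_compose[OF measurable_snd])
  qed simp
  have cyl_meas: "{x\<in>space \<nu>. \<forall>i\<in>I. x i = w i} \<in> sets \<nu>" for I :: "int set" and w
    by measurable
  have "(\<lambda>L. P.prob (E L)) \<longlonglongrightarrow> P.prob (\<Inter>L. E L)"
    using E_meas by (intro P.finite_Lim_measure_decseq) (auto simp: decseq_def E_def)
  moreover have "emeasure (\<nu> \<Otimes>\<^sub>M \<nu>) (\<Inter>L. E L) = 0"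
  proof -
    have "emeasure (\<nu> \<Otimes>\<^sub>M \<nu>) (\<Inter>L. E L) = (\<integral>\<^sup>+x. emeasure \<nu> (Pair x -` (\<Inter>L. E L)) \<partial>\<nu>)"
      using E_meas by (intro emeasure_pair_measure_alt) auto
    also have "\<dots> = (\<integral>\<^sup>+x. 0 \<partial>\<nu>)"
    proof (rule nn_integral_cong)
      fix x assume x: "x \<in> space \<nu>"
      have "{x} = {y\<in>space \<nu>. \<forall>i\<in>UNIV. y i = x i}" using x by auto
      then have "{x} \<in> sets \<nu>" using cyl_meas[of UNIV x] by simp
      moreover have "Pair x -` (\<Inter>L. E L) = {x}"
      proof -
        have "y = x" if "\<And>L. (x, y) \<in> E L" for y
        proof
          fix i
          \<comment> \<open>The window with \<open>L = \<bar>i\<bar>\<close> contains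
            \<open>i\<close>.\<close>
          show "y i = x i" using that[of "nat \<bar>i\<bar>"] by (auto simp: E_def dest!: bspec[of _ _ i])
        qed
        then show ?thesis using x by (auto simp: E_def space_pair_measure)
      qed
      ultimately show "emeasure \<nu> (Pair x -` (\<Inter>L. E L)) = 0"
        using nonatomic_singleton[OF assms(3)] by simp
    qed
    finally show ?thesis by simp
  qed
  ultimately have "(\<lambda>L. P.prob (E L)) \<longlonglongrightarrow> 0" by (simp add: measure_def)
  then have "\<forall>\<^sub>F L in sequentially. P.prob (E L) < \<kappa>\<^sup>2"
    using \<kappa> by (intro order_tendstoD(2)) auto
  then obtain L where L: "P.prob (E L) < \<kappa>\<^sup>2" by (auto dest: eventually_happens)
  have "prob {x\<in>space \<nu>. \<forall>i\<in>{- int L..int L}. x i = w i} \<le> \<kappa>" for w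
  proof -
    let ?A = "{x\<in>space \<nu>. \<forall>i\<in>{- int L..int L}. x i = w i}"
    have "(prob ?A)\<^sup>2 = P.prob (?A \<times> ?A)"
      using emeasure_pair_measure_Times[OF cyl_meas cyl_meas, of "{- int L..int L}" w "{- int L..int L}" w]
      by (simp add: measure_def enn2real_mult power2_eq_square)
    also have "\<dots> \<le> P.prob (E L)"
      using E_meas by (intro P.finite_measure_mono) (auto simp: E_def space_pair_measure)
    finally have "(prob ?A)\<^sup>2 \<le> \<kappa>\<^sup>2" using L by simp
    then show ?thesis using \<kappa> by (simp add: power2_le_iff_abs_le)
  qed
  then show ?thesis by blast
qed

text \<open>The cells are the cylinders over a window \<open>{-L..L}\<close> with small cylinders,
  numbered from 1. The window contains 0, so the code of a point determines its symbol there, which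
  \<open>sym\<close> recovers.\<close>

lemma ex_small_coding:
  assumes "prob_space \<nu>" and sets: "sets \<nu> = sets (full_shift_space k)" and "nonatomic \<nu>"
    and "0 < \<kappa>"
  shows "\<exists>(r::nat) c sym. c \<in> measurable \<nu> (count_space UNIV) \<and>
    (\<forall>x\<in>space \<nu>. c x \<in> {1..r} \<and> sym (c x) = x 0) \<and> (\<forall>j\<in>{1..r}. sym j \<in> {1..k}) \<and>
    (\<forall>j\<in>{1..r}. measure \<nu> {x\<in>space \<nu>. c x = j} \<le> \<kappa>)"
proof -
  note [measurable] = measurable_coordinate[OF sets]
  have sp: "space \<nu> = {x. \<forall>n. x n \<in> {1..k}}"
    using sets_eq_imp_space_eq[OF sets] by (simp add: space_full_shift_space)
  obtain L :: nat where L: "\<And>w. measure \<nu> {x\<in>space \<nu>. \<forall>i\<in>{- int L..int L}. x i = w i} \<le> \<kappa>"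
    using ex_window_small_cylinders[OF assms] by blast
  define I where "I = {- int L..int L}"
  define Q where "Q = (I \<rightarrow>\<^sub>E {1..k})"
  have "finite Q" by (simp add: Q_def I_def finite_PiE)
  then obtain h where h: "bij_betw h Q {1..card Q}"
    using finite_same_card_bij[of Q "{1..card Q}"] by auto
  define c where "c x = h (restrict x I)" for x
  have restr: "restrict x I \<in> Q" if "x \<in> space \<nu>" for x
    using that by (auto simp: Q_def sp)
  have level: "{x\<in>space \<nu>. c x = j} = {x\<in>space \<nu>. \<forall>i\<in>I. x i = inv_into Q h j i}" if j: "j \<in> {1..card Q}" for j
  proof -
    have "c x = j \<longleftrightarrow> (\<forall>i\<in>I. x i = inv_into Q h j i)" if x: "x \<in> space \<nu>" for x
    proof -
      have q: "inv_into Q h j \<in> Q" "h (inv_into Q h j) = j"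
        using h j by (auto simp: bij_betw_def inv_into_into f_inv_into_f)
      have "c x = j \<longleftrightarrow> restrict x I = inv_into Q h j"
        using h restr[OF x] q unfolding c_def bij_betw_def by (metis inj_onD)
      also have "\<dots> \<longleftrightarrow> (\<forall>i\<in>I. x i = inv_into Q h j i)"
        using q(1) unfolding Q_def by (auto simp: fun_eq_iff PiE_def extensional_def restrict_def)
      finally show ?thesis .
    qed
    then show ?thesis by auto
  qed
  have range: "c x \<in> {1..card Q}" if "x \<in> space \<nu>" for x
    using restr[OF that] h unfolding c_def bij_betw_def by blast
  have "c \<in> measurable \<nu> (count_space {1..card Q})"
  proof (rule measurable_count_space_eq2[THEN iffD2, OF finite_atLeastAtMost], intro conjI ballI)
    show "c \<in> space \<nu> \<rightarrow> {1..card Q}" using range by auto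
    fix j assume j: "j \<in> {1..card Q}"
    have "c -` {j} \<inter> space \<nu> = {x\<in>space \<nu>. c x = j}" by auto
    also have "\<dots> \<in> sets \<nu>" unfolding level[OF j] I_def by measurable
    finally show "c -` {j} \<inter> space \<nu> \<in> sets \<nu>" .
  qed
  then have c_meas: "c \<in> measurable \<nu> (count_space UNIV)"
    by (rule measurable_compose) simp
  have zero: "0 \<in> I" by (simp add: I_def)
  have sym: "inv_into Q h (c x) 0 = x 0" if "x \<in> space \<nu>" for x
    using restr[OF that] h zero by (simp add: c_def bij_betw_def inv_into_f_f)
  have sym_range: "inv_into Q h j 0 \<in> {1..k}" if "j \<in> {1..card Q}" for j
  proof -
    have "inv_into Q h j \<in> Q" using h that by (auto simp: bij_betw_def intro: inv_into_into)
    then show ?thesis using zero by (auto simp: Q_def)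
  qed
  have "measure \<nu> {x\<in>space \<nu>. c x = j} \<le> \<kappa>" if "j \<in> {1..card Q}" for j
    unfolding level[OF that] I_def by (rule L)
  with c_meas range sym sym_range show ?thesis
    by (intro exI[of _ "card Q"] exI[of _ c] exI[of _ "\<lambda>j. inv_into Q h j 0"]) blast
qed

section \<open>From towers to funny words\<close>

theorem theorem2p1:
  fixes k n M :: nat and \<nu> :: "(int \<Rightarrow> nat) measure" and \<epsilon> \<delta> :: real
  assumes "k \<ge> 1"
    and "prob_space \<nu>"
    and "sets \<nu> = sets (full_shift_space k)"
    and "nonatomic \<nu>"
    and "distr \<nu> \<nu> shift_map = \<nu>"
    and "n \<ge> 2"
    and "AT n \<nu> shift_map"
    and "\<not> AT (n - 1) \<nu> shift_map"
    and "\<epsilon> > 0" and "\<delta> > 0" and "M > 0"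
  shows "\<exists>(\<Lambda> :: nat \<Rightarrow> int set) (W :: nat \<Rightarrow> int \<Rightarrow> nat).
    (\<forall>i\<in>{1..n}. finite (\<Lambda> i)) \<and>
    (MIN i\<in>{1..n}. card (\<Lambda> i)) \<ge> M \<and>
    (\<forall>i\<in>{1..n}. W i \<in> funny_words k (\<Lambda> i)) \<and>
    (\<Sum>i=1..n. real (card (\<Lambda> i)) *
       measure \<nu> {x\<in>space (full_shift_space k). hamming_dist (\<Lambda> i) (restrict x (\<Lambda> i)) (W i) < \<epsilon>})
      > 1 - \<delta>"
proof -
  interpret prob_space \<nu> by fact
  note sets = assms(3)
  note coord [measurable] = measurable_coordinate[OF sets]
  have space: "space (full_shift_space k) = space \<nu>"
    using sets_eq_imp_space_eq[OF sets] by simp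
  have sp: "space \<nu> = {x. \<forall>n. x n \<in> {1..k}}"
    using space by (simp add: space_full_shift_space)
  define \<sigma> where "\<sigma> = \<delta> / real (n + 1)"
  define \<kappa> where "\<kappa> = \<sigma> / (4 * real M)"
  have \<sigma>: "0 < \<sigma>" "real (n + 1) * \<sigma> = \<delta>" using assms(10) by (auto simp: \<sigma>_def)
  have \<kappa>: "0 < \<kappa>" "4 * \<kappa> * real M \<le> \<sigma>" using \<sigma> assms(11) by (auto simp: \<kappa>_def)
  obtain r c and sym :: "nat \<Rightarrow> nat" where c: "c \<in> measurable \<nu> (count_space UNIV)"
    and range: "\<And>x. x \<in> space \<nu> \<Longrightarrow> c x \<in> {1..r}"
    and sym: "\<And>x. x \<in> space \<nu> \<Longrightarrow> sym (c x) = x 0" "\<And>j. j \<in> {1..r} \<Longrightarrow> sym j \<in> {1..k}"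
    and small: "\<And>j. j \<in> {1..r} \<Longrightarrow> prob {x\<in>space \<nu>. c x = j} \<le> \<kappa>"
    using ex_small_coding[OF assms(2-4) \<kappa>(1)] by blast
  define U where "U = int_iterate \<nu> shift_map"
  have U: "U z x = (\<lambda>i. x (i + z))" if "x \<in> space \<nu>" for z x
    unfolding U_def by (rule int_iterate_shift_map[OF sets that])
  have U_space: "U z x \<in> space \<nu>" if "x \<in> space \<nu>" for z x
    using that by (simp add: U sp)
  have U_meas: "U z \<in> measurable \<nu> \<nu>" for z
    using measurable_translation[OF sets, of z] by (simp add: U cong: measurable_cong)
  have U_distr: "distr \<nu> \<nu> (U z) = \<nu>" for z
    using distr_translation[OF sets assms(5), of z] by (simp add: U cong: distr_cong)
  have U_inv: "U (- z) (U z x) = x" if "x \<in> space \<nu>" for z x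
    using that U_space[OF that, of z] by (simp add: U)
  \<comment> \<open>Towers need a radius of at most 1; a smaller Hamming ball is good
    enough.\<close>
  have "0 < min \<epsilon> 1" "min \<epsilon> 1 \<le> 1" using assms(9) by auto
  then obtain \<Lambda> V where
    towers: "\<forall>m\<in>{1..n}. finite (\<Lambda> m) \<and> M \<le> card (\<Lambda> m) \<and> (\<forall>z. V m z \<in> {1..r})"
    and sum: "1 - real (n + 1) * \<sigma> < (\<Sum>m=1..n. real (card (\<Lambda> m)) *
      prob {x \<in> space \<nu>. real (card {z\<in>\<Lambda> m. c (U (- z) x) \<noteq> V m z}) < min \<epsilon> 1 * real (card (\<Lambda> m))})"
    using AT_ex_towers[OF assms(7) U_meas[unfolded U_def] U_distr[unfolded U_def] U_inv[unfolded U_def]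
      c range small \<kappa> _ _ \<sigma>(1), of "min \<epsilon> 1"]
    unfolding U_def[symmetric] by blast
  have \<Lambda>: "finite (\<Lambda> m)" "M \<le> card (\<Lambda> m)" and V: "V m z \<in> {1..r}" if "m \<in> {1..n}" for m z
    using towers that by blast+
  \<comment> \<open>The code of \<open>U (- z) x\<close> reveals the symbol of \<open>x\<close> at
    \<open>- z\<close>, so the base is reflected.\<close>
  define \<Lambda>' where "\<Lambda>' m = uminus ` \<Lambda> m" for m
  define W where "W m = restrict (\<lambda>i. sym (V m (- i))) (\<Lambda>' m)" for m
  have \<Lambda>': "finite (\<Lambda>' m)" "card (\<Lambda>' m) = card (\<Lambda> m)" if "m \<in> {1..n}" for m
    using \<Lambda>[OF that] by (auto simp: \<Lambda>'_def card_image)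
  have meas_le: "prob {x \<in> space \<nu>. real (card {z\<in>\<Lambda> m. c (U (- z) x) \<noteq> V m z}) < min \<epsilon> 1 * real (card (\<Lambda> m))}
    \<le> prob {x \<in> space \<nu>. hamming_dist (\<Lambda>' m) (restrict x (\<Lambda>' m)) (W m) < \<epsilon>}" if m: "m \<in> {1..n}" for m
  proof (rule finite_measure_mono)
    show "{x \<in> space \<nu>. real (card {z\<in>\<Lambda> m. c (U (- z) x) \<noteq> V m z}) < min \<epsilon> 1 * real (card (\<Lambda> m))}
      \<subseteq> {x \<in> space \<nu>. hamming_dist (\<Lambda>' m) (restrict x (\<Lambda>' m)) (W m) < \<epsilon>}"
    proof (intro subsetI CollectI conjI; elim CollectE conjE)
      fix x assume x: "x \<in> space \<nu>"
        and less: "real (card {z\<in>\<Lambda> m. c (U (- z) x) \<noteq> V m z}) < min \<epsilon> 1 * real (card (\<Lambda> m))"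
      \<comment> \<open>A wrong symbol forces a wrong code, so passing from codes to symbols can
        only lower the number of mismatches.\<close>
      have "{i\<in>\<Lambda>' m. restrict x (\<Lambda>' m) i \<noteq> W m i} \<subseteq> uminus ` {z\<in>\<Lambda> m. c (U (- z) x) \<noteq> V m z}"
      proof
        fix i assume "i \<in> {i\<in>\<Lambda>' m. restrict x (\<Lambda>' m) i \<noteq> W m i}"
        then obtain z where z: "z \<in> \<Lambda> m" "i = - z" "x (- z) \<noteq> sym (V m z)"
          by (auto simp: \<Lambda>'_def W_def)
        have "sym (c (U (- z) x)) = x (- z)"
          using sym(1)[OF U_space[OF x, of "- z"]] by (simp add: U[OF x])
        then have "c (U (- z) x) \<noteq> V m z" using z by auto
        with z show "i \<in> uminus ` {z\<in>\<Lambda> m. c (U (- z) x) \<noteq> V m z}" by auto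
      qed
      then have "card {i\<in>\<Lambda>' m. restrict x (\<Lambda>' m) i \<noteq> W m i} \<le> card {z\<in>\<Lambda> m. c (U (- z) x) \<noteq> V m z}"
        using \<Lambda>(1)[OF m] by (intro surj_card_le) auto
      then have "real (card {i\<in>\<Lambda>' m. restrict x (\<Lambda>' m) i \<noteq> W m i}) < min \<epsilon> 1 * real (card (\<Lambda> m))"
        using less by linarith
      also have "\<dots> \<le> \<epsilon> * real (card (\<Lambda> m))" by (intro mult_right_mono) auto
      \<comment> \<open>\<open>M > 0\<close> makes the base nonempty, so the quotient is not the
        default value of division by 0.\<close>
      finally show "hamming_dist (\<Lambda>' m) (restrict x (\<Lambda>' m)) (W m) < \<epsilon>"
        using \<Lambda>(2)[OF m] assms(11) \<Lambda>'(2)[OF m] by (simp add: hamming_dist_def divide_less_eq)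
    qed auto
    \<comment> \<open>As a finite sum of functions of single coordinates the distance is
      measurable.\<close>
    have "hamming_dist (\<Lambda>' m) (restrict x (\<Lambda>' m)) (W m)
      = (\<Sum>i\<in>\<Lambda>' m. if x i = W m i then 0 else 1) / real (card (\<Lambda>' m))" for x
    proof -
      have "real (card {i\<in>\<Lambda>' m. restrict x (\<Lambda>' m) i \<noteq> W m i}) = (\<Sum>i\<in>\<Lambda>' m. if x i \<noteq> W m i then 1 else 0)"
        using \<Lambda>'(1)[OF m] by (simp add: sum.If_cases Int_def cong: conj_cong)
      also have "\<dots> = (\<Sum>i\<in>\<Lambda>' m. if x i = W m i then 0 else 1)" by (intro sum.cong) auto
      finally show ?thesis by (simp add: hamming_dist_def)
    qed
    then show "{x \<in> space \<nu>. hamming_dist (\<Lambda>' m) (restrict x (\<Lambda>' m)) (W m) < \<epsilon>} \<in> events"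
      by simp
  qed
  have "1 - \<delta> < (\<Sum>m=1..n. real (card (\<Lambda> m)) *
      prob {x \<in> space \<nu>. real (card {z\<in>\<Lambda> m. c (U (- z) x) \<noteq> V m z}) < min \<epsilon> 1 * real (card (\<Lambda> m))})"
    using sum \<sigma> by simp
  also have "\<dots> \<le> (\<Sum>m=1..n. real (card (\<Lambda>' m)) *
      prob {x \<in> space (full_shift_space k). hamming_dist (\<Lambda>' m) (restrict x (\<Lambda>' m)) (W m) < \<epsilon>})"
    using meas_le \<Lambda>' unfolding space by (intro sum_mono mult_mono) auto
  finally have "1 - \<delta> < \<dots>" .
  \<comment> \<open>\<open>n \<ge> 2\<close> ensures that the minimum is taken over a nonempty
    set.\<close>
  moreover have "M \<le> (MIN i\<in>{1..n}. card (\<Lambda>' i))"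
    using assms(6) \<Lambda>(2) \<Lambda>'(2) by (subst Min_ge_iff) auto
  moreover have "\<forall>i\<in>{1..n}. W i \<in> funny_words k (\<Lambda>' i)"
    using sym(2) V by (auto simp: W_def funny_words_def)
  ultimately show ?thesis using \<Lambda>'(1) by (intro exI[of _ \<Lambda>'] exI[of _ W]) blast
qed

end
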